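(* Let $L>0$, $\sigma\in[-L,L]$, $\lambda>0$ and $\gamma>0$. Say that DRS with stepsize $\gamma$ and relaxation $\lambda$ is *ensured to converge* on the class $\mathcal C(L,\sigma)$ if, for every $p\ge1$, every pair $(\varphi_1,\varphi_2)\in\mathcal C(L,\sigma)$ of functions on $\mathbb R^p$, and every $s^0\in\mathbb R^p$, every sequence $(s^k,u^k,v^k)_k$ generated by DRS with stepsize $\gamma$ and relaxation $\lambda$ starting from $s^0$ satisfies $u^k-v^k\to0$ as $k\to\infty$. Then: (a) If $\lambda\in(0,2)$, DRS is ensured to converge on $\mathcal C(L,\sigma)$ if and only if $\gamma<\min\{\frac1L,\frac{2-\lambda}{2[\sigma]_-}\}$. (b) If $\lambda\ge2$ and $\sigma\le0$, DRS is not ensured to converge on $\mathcal C(L,\sigma)$ for any $\gamma>0$. (c) If $\lambda=2$ (Peaceman-Rachford splitting), DRS is ensured to converge on $\mathcal C(L,\sigma)$ if and only if $\sigma>0$ and $\gamma<\frac1L$.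
   Context: $\mathcal C(L,\sigma)$ is the class of pairs $(\varphi_1,\varphi_2)$ such that, for some $p\geq 1$: $\varphi_1:\mathbb R^p\to\mathbb R$ is $L$-smooth (differentiable with $L$-Lipschitz gradient) and $\sigma$-hypoconvex, meaning $\varphi_1-\frac\sigma2\|\cdot\|^2$ is convex; $\varphi_2:\mathbb R^p\to\mathbb R\cup\{\infty\}$ is proper and lower semicontinuous; and $\operatorname{argmin}(\varphi_1+\varphi_2)\ne\emptyset$. Notation: $[r]_-=\max\{0,-r\}$, with $r/0=\infty$ for $r>0$. $\operatorname{prox}_{\gamma h}(x)=\operatorname{argmin}_w\{h(w)+\frac1{2\gamma}\|w-x\|^2\}$ (possibly set-valued). DRS iterates, for $k\ge0$: $u^k\in\operatorname{prox}_{\gamma\varphi_1}(s^k)$, $v^k\in\operatorname{prox}_{\gamma\varphi_2}(2u^k-s^k)$, $s^{k+1}=s^k+\lambda(v^k-u^k)$, where any selection from the prox sets is allowed. *)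

theory Defs
  imports "HOL-Analysis.Analysis"
begin

section \<open>Euclidean spaces of variable dimension\<close>

text \<open>
  The dimension \<open>p\<close> of the underlying space is quantified inside the notion ``ensured to
  converge'', so it cannot be a type.  All the spaces are therefore realised inside one inner product
  space: the finitely supported real sequences with the Euclidean inner product.  Euclidean
  \<open>p\<close>-space is the subspace of sequences that vanish from index \<open>p\<close> on
  (see \<open>euclid_ex1\<close> and \<open>inner_euclid\<close> below), and everything that follows is relative to
  that subspace: values of functions outside it are irrelevant.
\<close>

typedef finseq = "{x :: nat \<Rightarrow> real. finite {i. x i \<noteq> 0}}"
  morphisms coord Abs_finseq
  by (rule exI[of _ "\<lambda>_. 0"]) simp

setup_lifting type_definition_finseq

lemma finite_supp [simp]: "finite {i. coord x i \<noteq> 0}"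
  using coord[of x] by simp

lemma finseq_eqI: "(\<And>i. coord x i = coord y i) \<Longrightarrow> x = y"
  by (simp add: coord_inject[symmetric] ext)

instantiation finseq :: real_vector
begin

lift_definition zero_finseq :: finseq is "\<lambda>_. 0" by simp

lift_definition plus_finseq :: "finseq \<Rightarrow> finseq \<Rightarrow> finseq" is "\<lambda>x y i. x i + y i"
  subgoal for x y by (rule finite_subset[of _ "{i. x i \<noteq> 0} \<union> {i. y i \<noteq> 0}"]) auto
  done

lift_definition minus_finseq :: "finseq \<Rightarrow> finseq \<Rightarrow> finseq" is "\<lambda>x y i. x i - y i"
  subgoal for x y by (rule finite_subset[of _ "{i. x i \<noteq> 0} \<union> {i. y i \<noteq> 0}"]) auto
  done

lift_definition uminus_finseq :: "finseq \<Rightarrow> finseq" is "\<lambda>x i. - x i" by simp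

lift_definition scaleR_finseq :: "real \<Rightarrow> finseq \<Rightarrow> finseq" is "\<lambda>r x i. r * x i"
  subgoal for r x by (rule finite_subset[of _ "{i. x i \<noteq> 0}"]) auto
  done

instance
  by standard (transfer; simp add: fun_eq_iff algebra_simps)+

end

lemma coord_simps [simp]:
  "coord 0 i = 0"
  "coord (x + y) i = coord x i + coord y i"
  "coord (x - y) i = coord x i - coord y i"
  "coord (- x) i = - coord x i"
  "coord (r *\<^sub>R x) i = r * coord x i"
  by (transfer; simp)+

lemma sum_supp:
  assumes "finite A" "{i. coord x i \<noteq> 0} \<subseteq> A"
  shows "(\<Sum>i | coord x i \<noteq> 0. coord x i * coord y i) = (\<Sum>i\<in>A. coord x i * coord y i)"
  by (rule sum.mono_neutral_left) (use assms in auto)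

instantiation finseq :: real_inner
begin

definition inner_finseq :: "finseq \<Rightarrow> finseq \<Rightarrow> real" where
  "inner_finseq x y = (\<Sum>i | coord x i \<noteq> 0. coord x i * coord y i)"

definition norm_finseq :: "finseq \<Rightarrow> real" where
  "norm_finseq x = sqrt (inner x x)"

definition sgn_finseq :: "finseq \<Rightarrow> finseq" where
  "sgn_finseq x = x /\<^sub>R norm x"

definition dist_finseq :: "finseq \<Rightarrow> finseq \<Rightarrow> real" where
  "dist_finseq x y = norm (x - y)"

definition uniformity_finseq :: "(finseq \<times> finseq) filter" where
  "uniformity_finseq = (INF e\<in>{0 <..}. principal {(x, y). dist x y < e})"

definition open_finseq :: "finseq set \<Rightarrow> bool" where
  "open_finseq U = (\<forall>x\<in>U. eventually (\<lambda>(x', y). x' = x \<longrightarrow> y \<in> U) uniformity)"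

instance
proof
  fix x y z :: finseq and r :: real
  let ?S = "\<lambda>x. {i. coord x i \<noteq> 0}"
  let ?A = "?S x \<union> ?S y \<union> ?S (x + y) \<union> ?S (r *\<^sub>R x)"
  have fin: "finite ?A" by (intro finite_UnI finite_supp)
  have *: "inner w v = (\<Sum>i\<in>?A. coord w i * coord v i)" if "?S w \<subseteq> ?A" for w v
    unfolding inner_finseq_def by (rule sum_supp[OF fin that])
  have sx: "?S x \<subseteq> ?A" and sy: "?S y \<subseteq> ?A" and sxy: "?S (x + y) \<subseteq> ?A"
    and srx: "?S (r *\<^sub>R x) \<subseteq> ?A" by blast+
  show "inner x y = inner y x"
    unfolding *[OF sx] *[OF sy] by (simp add: mult.commute)
  show "inner (x + y) z = inner x z + inner y z"
    unfolding *[OF sx] *[OF sy] *[OF sxy] by (simp add: sum.distrib distrib_right)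
  show "inner (r *\<^sub>R x) y = r * inner x y"
    unfolding *[OF sx] *[OF srx] by (simp add: sum_distrib_left mult.assoc)
  show "0 \<le> inner x x"
    by (simp add: inner_finseq_def sum_nonneg)
  show "inner x x = 0 \<longleftrightarrow> x = 0"
  proof
    assume "inner x x = 0"
    then have "\<forall>i\<in>?S x. coord x i * coord x i = 0"
      unfolding inner_finseq_def by (subst (asm) sum_nonneg_eq_0_iff) auto
    then show "x = 0"
      by (intro finseq_eqI) auto
  qed (simp add: inner_finseq_def)
qed (auto simp: norm_finseq_def sgn_finseq_def dist_finseq_def uniformity_finseq_def open_finseq_def)

end

definition euclid :: "nat \<Rightarrow> finseq set" where
  "euclid p = {x. \<forall>i\<ge>p. coord x i = 0}"

lemma subspace_euclid: "subspace (euclid p)"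
  by (auto simp: subspace_def euclid_def)

lemma inner_euclid:
  assumes "x \<in> euclid p"
  shows "inner x y = (\<Sum>i<p. coord x i * coord y i)"
  unfolding inner_finseq_def
  by (rule sum_supp) (use assms in \<open>auto simp: euclid_def not_le[symmetric]\<close>)

lemma euclid_ex1: "\<exists>!x. x \<in> euclid p \<and> (\<forall>i<p. coord x i = f i)"
proof (rule ex1I)
  have "finite {i. (if i < p then f i else 0) \<noteq> 0}"
    by (rule finite_subset[of _ "{..<p}"]) auto
  then have c: "coord (Abs_finseq (\<lambda>i. if i < p then f i else 0)) = (\<lambda>i. if i < p then f i else 0)"
    by (simp add: Abs_finseq_inverse)
  show "Abs_finseq (\<lambda>i. if i < p then f i else 0) \<in> euclid p \<and>
    (\<forall>i<p. coord (Abs_finseq (\<lambda>i. if i < p then f i else 0)) i = f i)"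
    by (simp add: c euclid_def)
  fix x assume "x \<in> euclid p \<and> (\<forall>i<p. coord x i = f i)"
  then have "coord x = coord (Abs_finseq (\<lambda>i. if i < p then f i else 0))"
    unfolding c by (auto simp: euclid_def fun_eq_iff)
  then show "x = Abs_finseq (\<lambda>i. if i < p then f i else 0)"
    by (simp add: coord_inject)
qed


section \<open>The function class\<close>

text \<open>
  The requirement that the gradient \<open>g\<close> takes its values in the subspace \<open>V\<close> makes it the
  gradient of \<open>f\<close> as a function on \<open>V\<close>; a component orthogonal to \<open>V\<close> would not be
  determined by the derivative within \<open>V\<close>.
\<close>

definition L_smooth_on :: "real \<Rightarrow> 'a::real_inner set \<Rightarrow> ('a \<Rightarrow> real) \<Rightarrow> bool" where
  "L_smooth_on L V f \<longleftrightarrow>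
     (\<exists>g. (\<forall>x\<in>V. g x \<in> V \<and> (f has_derivative (\<lambda>h. inner (g x) h)) (at x within V)) \<and>
          L-lipschitz_on V g)"

definition hypoconvex_on :: "real \<Rightarrow> 'a::real_inner set \<Rightarrow> ('a \<Rightarrow> real) \<Rightarrow> bool" where
  "hypoconvex_on \<sigma> V f \<longleftrightarrow> convex_on V (\<lambda>x. f x - \<sigma> / 2 * (norm x)\<^sup>2)"

text \<open>
  The first conjunct excludes \<open>-\<infinity>\<close>, so that \<open>h\<close> is a function into the
  reals extended by \<open>\<infinity>\<close> only.
\<close>

definition proper_on :: "'a set \<Rightarrow> ('a \<Rightarrow> ereal) \<Rightarrow> bool" where
  "proper_on V h \<longleftrightarrow> (\<forall>x\<in>V. h x \<noteq> -\<infinity>) \<and> (\<exists>x\<in>V. h x \<noteq> \<infinity>)"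

definition lsc_on :: "'a::topological_space set \<Rightarrow> ('a \<Rightarrow> ereal) \<Rightarrow> bool" where
  "lsc_on V h \<longleftrightarrow> (\<forall>x\<in>V. h x \<le> Liminf (at x within V) h)"

definition argmin_on :: "'a set \<Rightarrow> ('a \<Rightarrow> ereal) \<Rightarrow> 'a set" where
  "argmin_on V h = {x. is_arg_min h (\<lambda>w. w \<in> V) x}"

text \<open>The pairs of functions on Euclidean \<open>p\<close>-space that belong to the class.\<close>

definition class_C ::
  "nat \<Rightarrow> real \<Rightarrow> real \<Rightarrow> ((finseq \<Rightarrow> real) \<times> (finseq \<Rightarrow> ereal)) set" where
  "class_C p L \<sigma> = {(\<phi>\<^sub>1, \<phi>\<^sub>2).
     L_smooth_on L (euclid p) \<phi>\<^sub>1 \<and> hypoconvex_on \<sigma> (euclid p) \<phi>\<^sub>1 \<and>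
     proper_on (euclid p) \<phi>\<^sub>2 \<and> lsc_on (euclid p) \<phi>\<^sub>2 \<and>
     argmin_on (euclid p) (\<lambda>x. ereal (\<phi>\<^sub>1 x) + \<phi>\<^sub>2 x) \<noteq> {}}"


section \<open>Douglas--Rachford splitting\<close>

definition prox_on ::
  "'a::real_inner set \<Rightarrow> real \<Rightarrow> ('a \<Rightarrow> ereal) \<Rightarrow> 'a \<Rightarrow> 'a set" where
  "prox_on V \<gamma> h x = argmin_on V (\<lambda>w. h w + ereal (1 / (2 * \<gamma>) * (norm (w - x))\<^sup>2))"

definition DRS_sequence ::
  "'a::real_inner set \<Rightarrow> real \<Rightarrow> real \<Rightarrow> ('a \<Rightarrow> real) \<Rightarrow> ('a \<Rightarrow> ereal) \<Rightarrow> 'a \<Rightarrow>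
   (nat \<Rightarrow> 'a) \<Rightarrow> (nat \<Rightarrow> 'a) \<Rightarrow> (nat \<Rightarrow> 'a) \<Rightarrow> bool" where
  "DRS_sequence V \<gamma> lam \<phi>\<^sub>1 \<phi>\<^sub>2 s0 s u v \<longleftrightarrow>
     s 0 = s0 \<and>
     (\<forall>k. u k \<in> prox_on V \<gamma> (\<lambda>x. ereal (\<phi>\<^sub>1 x)) (s k) \<and>
          v k \<in> prox_on V \<gamma> \<phi>\<^sub>2 (2 *\<^sub>R u k - s k) \<and>
          s (Suc k) = s k + lam *\<^sub>R (v k - u k))"

definition DRS_ensured_to_converge :: "real \<Rightarrow> real \<Rightarrow> real \<Rightarrow> real \<Rightarrow> bool" where
  "DRS_ensured_to_converge \<gamma> lam L \<sigma> \<longleftrightarrow>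
     (\<forall>p\<ge>1. \<forall>(\<phi>\<^sub>1, \<phi>\<^sub>2)\<in>class_C p L \<sigma>. \<forall>s0\<in>euclid p. \<forall>s u v.
        DRS_sequence (euclid p) \<gamma> lam \<phi>\<^sub>1 \<phi>\<^sub>2 s0 s u v \<longrightarrow> (\<lambda>k. u k - v k) \<longlonglongrightarrow> 0)"

definition neg_part :: "real \<Rightarrow> real" where
  "neg_part r = max 0 (- r)"

text \<open>
  The convention \<open>r / 0 = \<infinity>\<close> for \<open>r > 0\<close> is that of division on \<^typ>\<open>ereal\<close>,
  in contrast to division on \<^typ>\<open>real\<close>.
\<close>

lemma ereal_pos_divide_zero: "0 < r \<Longrightarrow> ereal r / ereal 0 = \<infinity>"
  by (simp add: divide_ereal_def)

end

theory Submission
  imports Defs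
begin

text \<open>
  \<^emph>\<open>Sufficiency.\<close>  Since \<open>u\<close> is a stationary point of its proximal problem,
  \<open>s = u + \<gamma> \<nabla>\<phi>\<^sub>1(u)\<close>, and \<open>v\<close> minimises
  \<open>w \<mapsto> \<phi>\<^sub>2(w) + \<phi>\<^sub>1(u) + \<langle>\<nabla>\<phi>\<^sub>1(u), w - u\<rangle> + \<parallel>w - u\<parallel>\<^sup>2 / (2\<gamma>)\<close>.
  The minimal value, the Douglas--Rachford envelope at \<open>s\<close>, serves as a Lyapunov function.
  For \<open>\<gamma>L \<le> 1\<close> it is at least the minimum of \<open>\<phi>\<^sub>1 + \<phi>\<^sub>2\<close>
  (\<open>model_above\<close>).  To estimate the next value from above, the old \<open>v\<close> is used as a
  competitor; \<open>\<phi>\<^sub>2\<close> then cancels, and an exact computation (\<open>model_change\<close>) shows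
  that what remains depends only on \<open>u\<close>, the next \<open>u\<close>, and the values and gradients of
  \<open>\<phi>\<^sub>1\<close> there.
  The interpolation inequality for smooth hypoconvex functions turns this into a quadratic form
  in the differences of the points and of the gradients.  For \<open>\<sigma> \<le> 0\<close> its smallest values occur
  for quadratic functions of curvature \<open>\<sigma>\<close> or \<open>L\<close>, where it is proportional to
  \<open>(1 - \<gamma>c) (2 + 2\<gamma>c - \<lambda>)\<close> with \<open>c\<close> the curvature; this is where the bounds on
  \<open>\<gamma>\<close> and \<open>\<lambda>\<close> come from.  For \<open>\<sigma> > 0\<close> and \<open>\<lambda> < 2\<close> one may argue with the
  modulus \<open>0\<close> instead, and for \<open>\<lambda> = 2\<close> a positive modulus makes the form positive definite.
  Positivity of the form makes the steps of \<open>u\<close>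
  square summable, and the relation between \<open>s\<close> and \<open>u\<close> carries this over to
  \<open>u - v\<close> (\<open>DRS_residual_tendsto_zero\<close>).

  \<^emph>\<open>Necessity.\<close>  Two examples on the real line, both with quadratic \<open>\<phi>\<^sub>1\<close>, account for
  the failures of convergence.  If \<open>\<gamma>L \<ge> 1\<close>, take curvature \<open>L\<close> and for
  \<open>\<phi>\<^sub>2\<close> the indicator of \<open>{-1, 1}\<close>: the point \<open>2u - s\<close> is then a nonpositive
  multiple of \<open>s\<close>, so that \<open>v\<close> can always be chosen with
  \<open>u v \<le> 0\<close>, which keeps \<open>u\<close> and \<open>v\<close> at distance at least one.  If \<open>\<gamma>L < 1\<close>, \<open>\<sigma> \<le> 0\<close> and \<open>\<lambda> \<ge> 2 (1 + \<gamma>\<sigma>)\<close>, take curvature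
  \<open>\<sigma>\<close> and the indicator of the origin: the iteration becomes linear, with a factor of modulus
  at least one.
\<close>

section \<open>Smooth hypoconvex functions\<close>

lemma norm_add_scaleR_power2:
  fixes x y :: "'a::real_inner"
  shows "(norm (x + c *\<^sub>R y))\<^sup>2 = (norm x)\<^sup>2 + 2 * c * inner x y + c\<^sup>2 * (norm y)\<^sup>2"
  unfolding power2_norm_eq_inner by (simp add: inner_commute power2_eq_square algebra_simps)

text \<open>
  The gradient within \<open>V\<close> is made a parameter because the estimates below compare its values at
  several points.
\<close>

locale smooth_hypoconvex =
  fixes V :: "'a::real_inner set" and \<phi> :: "'a \<Rightarrow> real" and g :: "'a \<Rightarrow> 'a" and L \<sigma> :: real
  assumes subspace_V: "subspace V"
    and grad_mem: "x \<in> V \<Longrightarrow> g x \<in> V"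
    and has_grad: "x \<in> V \<Longrightarrow> (\<phi> has_derivative (\<lambda>h. inner (g x) h)) (at x within V)"
    and grad_lipschitz: "L-lipschitz_on V g"
    and hypoconvex: "hypoconvex_on \<sigma> V \<phi>"
begin

lemma mem_simps:
  "x \<in> V \<Longrightarrow> y \<in> V \<Longrightarrow> x + y \<in> V"
  "x \<in> V \<Longrightarrow> y \<in> V \<Longrightarrow> x - y \<in> V"
  "x \<in> V \<Longrightarrow> c *\<^sub>R x \<in> V"
  using subspace_V by (simp_all add: subspace_add subspace_diff subspace_scale)

text \<open>
  The derivative within \<open>V\<close> controls \<open>\<phi>\<close> only along \<open>V\<close>.  Restricting to
  lines in \<open>V\<close> reduces all first-order facts to functions of one real variable.
\<close>

lemma line_derivative:
  assumes "x \<in> V" "d \<in> V"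
  shows "((\<lambda>\<tau>. \<phi> (x + \<tau> *\<^sub>R d)) has_real_derivative inner (g (x + \<tau> *\<^sub>R d)) d) (at \<tau>)"
proof -
  have "((\<lambda>\<tau>. \<phi> (x + \<tau> *\<^sub>R d)) has_derivative (\<lambda>t. inner (g (x + \<tau> *\<^sub>R d)) (t *\<^sub>R d))) (at \<tau>)"
  proof (rule has_derivative_in_compose2[where t = V and s = UNIV and g = \<phi>
        and g' = "\<lambda>x h. inner (g x) h" and f = "\<lambda>\<tau>. x + \<tau> *\<^sub>R d" and f' = "\<lambda>t. t *\<^sub>R d"])
    show "(\<lambda>\<tau>. x + \<tau> *\<^sub>R d) ` UNIV \<subseteq> V" using assms by (auto intro!: mem_simps)
    show "((\<lambda>\<tau>. x + \<tau> *\<^sub>R d) has_derivative (\<lambda>t. t *\<^sub>R d)) (at \<tau>)"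
      by (auto intro!: derivative_eq_intros)
  qed (simp_all add: has_grad)
  then show ?thesis
    by (simp add: has_field_derivative_def mult_commute_abs)
qed

text \<open>
  Along the segment, the slope of \<open>\<phi>\<close> per unit length exceeds its initial value at most by
  \<open>L\<close> times the distance covered, by Cauchy--Schwarz.
\<close>

lemma descent:
  assumes "x \<in> V" "y \<in> V"
  shows "\<phi> y \<le> \<phi> x + inner (g x) (y - x) + L / 2 * (norm (y - x))\<^sup>2"
proof -
  define d where "d = y - x"
  have d: "d \<in> V" using assms by (simp add: d_def mem_simps)
  define \<psi> where
    "\<psi> \<tau> = \<phi> (x + \<tau> *\<^sub>R d) - \<tau> * inner (g x) d - L / 2 * \<tau>\<^sup>2 * (norm d)\<^sup>2" for \<tau> :: real
  have "\<psi> 1 \<le> \<psi> 0"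
  proof (rule DERIV_nonpos_imp_nonincreasing[where f = \<psi>])
    fix \<tau> :: real assume \<tau>: "0 \<le> \<tau>" "\<tau> \<le> 1"
    let ?D = "inner (g (x + \<tau> *\<^sub>R d)) d - inner (g x) d - L * \<tau> * (norm d)\<^sup>2"
    have "(\<psi> has_real_derivative ?D) (at \<tau>)"
      unfolding \<psi>_def
      by (auto intro!: derivative_eq_intros line_derivative assms(1) d)
    moreover have "norm (g (x + \<tau> *\<^sub>R d) - g x) \<le> L * \<tau> * norm d"
      using lipschitz_onD[OF grad_lipschitz, of "x + \<tau> *\<^sub>R d" x] assms(1) d \<tau>
      by (simp add: dist_norm mem_simps mult.assoc)
    then have "inner (g (x + \<tau> *\<^sub>R d) - g x) d \<le> L * \<tau> * norm d * norm d"
      by (meson mult_right_mono norm_cauchy_schwarz norm_ge_zero order_trans)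
    then have "?D \<le> 0" by (simp add: inner_diff_left power2_eq_square mult.assoc)
    ultimately show "\<exists>D. (\<psi> has_real_derivative D) (at \<tau>) \<and> D \<le> 0" by blast
  qed simp
  then show ?thesis by (simp add: \<psi>_def d_def)
qed

text \<open>
  Once the quadratic of curvature \<open>\<sigma>\<close> is subtracted, this is the tangent inequality of a convex
  function.  A smaller modulus \<open>\<sigma>'\<close> is admitted because the later estimates need one that is
  strictly below \<open>L\<close>, and in one of two cases nonpositive.
\<close>

lemma above_tangent:
  assumes "x \<in> V" "y \<in> V" "\<sigma>' \<le> \<sigma>"
  shows "\<phi> x + inner (g x) (y - x) + \<sigma>' / 2 * (norm (y - x))\<^sup>2 \<le> \<phi> y"
proof -
  define d where "d = y - x"
  have d: "d \<in> V" using assms by (simp add: d_def mem_simps)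
  define \<psi> where "\<psi> \<tau> = \<phi> (x + \<tau> *\<^sub>R d) - \<sigma> / 2 * (norm (x + \<tau> *\<^sub>R d))\<^sup>2" for \<tau> :: real
  have expand: "(norm (x + \<tau> *\<^sub>R d))\<^sup>2 = (norm x)\<^sup>2 + 2 * \<tau> * inner x d + \<tau>\<^sup>2 * (norm d)\<^sup>2" for \<tau>
    by (rule norm_add_scaleR_power2)
  have "convex_on UNIV \<psi>"
  proof (rule convex_onI)
    fix t a b :: real assume t: "t > 0" "t < 1"
    have "x + ((1 - t) *\<^sub>R a + t *\<^sub>R b) *\<^sub>R d
        = (1 - t) *\<^sub>R (x + a *\<^sub>R d) + t *\<^sub>R (x + b *\<^sub>R d)"
      by (simp add: algebra_simps)
    then show "\<psi> ((1 - t) *\<^sub>R a + t *\<^sub>R b) \<le> (1 - t) * \<psi> a + t * \<psi> b"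
      using hypoconvex convex_onD[of V "\<lambda>x. \<phi> x - \<sigma> / 2 * (norm x)\<^sup>2" t "x + a *\<^sub>R d" "x + b *\<^sub>R d"]
        t assms(1) d
      unfolding \<psi>_def hypoconvex_on_def by (simp add: mem_simps)
  qed simp
  moreover have "(\<psi> has_real_derivative inner (g x) d - \<sigma> * inner x d) (at 0)"
    using line_derivative[OF assms(1) d, of 0] unfolding \<psi>_def expand
    by (auto intro!: derivative_eq_intros)
  ultimately have "(inner (g x) d - \<sigma> * inner x d) * (1 - 0) \<le> \<psi> 1 - \<psi> 0"
    by (intro convex_on_imp_above_tangent[where A = UNIV]) auto
  then have "\<phi> x + inner (g x) d + \<sigma> / 2 * (norm d)\<^sup>2 \<le> \<phi> y"
    unfolding \<psi>_def expand by (simp add: algebra_simps) (simp add: d_def algebra_simps)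
  moreover have "\<sigma>' / 2 * (norm d)\<^sup>2 \<le> \<sigma> / 2 * (norm d)\<^sup>2"
    using assms(3) by (intro mult_right_mono) auto
  ultimately show ?thesis unfolding d_def by linarith
qed

text \<open>
  The value of \<open>\<phi>\<close> at an auxiliary point lies above the lower bound anchored at \<open>y\<close> and
  below the upper bound anchored at \<open>x\<close>.  The gap between the two bounds is a quadratic of
  curvature \<open>L - \<sigma>'\<close> in the auxiliary point; evaluating it at its minimiser \<open>x + w\<close>
  gives the strongest conclusion.
\<close>

lemma interpolation:
  assumes "x \<in> V" "y \<in> V" "\<sigma>' \<le> \<sigma>" "\<sigma>' < L"
  shows "\<sigma>' / 2 * (norm (x - y))\<^sup>2 + (norm (g x - g y - \<sigma>' *\<^sub>R (x - y)))\<^sup>2 / (2 * (L - \<sigma>'))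
         \<le> \<phi> x - \<phi> y - inner (g y) (x - y)"
proof -
  define t where "t = L - \<sigma>'"
  define d where "d = x - y"
  define f where "f = g x - g y - \<sigma>' *\<^sub>R d"
  define q where "q = (norm f)\<^sup>2 / (2 * t)"
  define w where "w = - (1 / t) *\<^sub>R f"
  have t: "t > 0" using assms by (simp add: t_def)
  have w: "w \<in> V"
    unfolding w_def by (rule mem_simps(3)) (simp add: f_def d_def mem_simps grad_mem assms)
  have "\<phi> y + inner (g y) (d + w) + \<sigma>' / 2 * (norm (d + w))\<^sup>2 \<le> \<phi> (x + w)"
    using above_tangent[OF assms(2) mem_simps(1)[OF assms(1) w] assms(3)]
    by (simp add: d_def add_diff_eq diff_add_eq)
  moreover have "\<phi> (x + w) \<le> \<phi> x + inner (g x) w + L / 2 * (norm w)\<^sup>2"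
    using descent[OF assms(1) mem_simps(1)[OF assms(1) w]] by simp
  moreover have "(norm (d + w))\<^sup>2 = (norm d)\<^sup>2 + 2 * inner d w + (norm w)\<^sup>2"
    using norm_add_scaleR_power2[of d 1 w] by simp
  then have "\<sigma>' / 2 * (norm (d + w))\<^sup>2
      = \<sigma>' / 2 * (norm d)\<^sup>2 + \<sigma>' * inner d w + \<sigma>' / 2 * (norm w)\<^sup>2"
    by (simp add: distrib_left)
  moreover have "inner f w = - 2 * q"
    by (simp add: w_def q_def power2_norm_eq_inner)
  then have "inner (g x) w - inner (g y) w - \<sigma>' * inner d w = - 2 * q"
    by (simp add: f_def inner_diff_left)
  moreover have "(norm w)\<^sup>2 = (norm f)\<^sup>2 / t\<^sup>2"
    by (simp add: w_def power_divide)
  then have "t / 2 * (norm w)\<^sup>2 = q"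
    using t by (simp add: power2_eq_square q_def)
  then have "L / 2 * (norm w)\<^sup>2 - \<sigma>' / 2 * (norm w)\<^sup>2 = q"
    by (simp only: t_def diff_divide_distrib left_diff_distrib)
  ultimately have "\<sigma>' / 2 * (norm d)\<^sup>2 + q \<le> \<phi> x - \<phi> y - inner (g y) d"
    unfolding inner_add_right by linarith
  then show ?thesis by (simp only: q_def f_def d_def t_def)
qed

text \<open>
  Adding the interpolation inequality to the one with \<open>x\<close> and \<open>y\<close> exchanged cancels
  the function values.
\<close>

lemma cocoercive:
  assumes "x \<in> V" "y \<in> V" "\<sigma>' \<le> \<sigma>" "\<sigma>' < L"
  shows "(norm (g x - g y - \<sigma>' *\<^sub>R (x - y)))\<^sup>2
         \<le> (L - \<sigma>') * inner (g x - g y - \<sigma>' *\<^sub>R (x - y)) (x - y)"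
proof -
  define d where "d = x - y"
  define f where "f = g x - g y - \<sigma>' *\<^sub>R d"
  define q where "q = (norm f)\<^sup>2 / (2 * (L - \<sigma>'))"
  have "g y - g x - \<sigma>' *\<^sub>R (y - x) = - f" "y - x = - d"
    by (simp_all add: f_def d_def algebra_simps)
  then have "\<sigma>' / 2 * (norm d)\<^sup>2 + q \<le> \<phi> y - \<phi> x + inner (g x) d"
    using interpolation[OF assms(2,1,3,4)] by (simp add: q_def)
  moreover have "\<sigma>' / 2 * (norm d)\<^sup>2 + q \<le> \<phi> x - \<phi> y - inner (g y) d"
    using interpolation[OF assms] by (simp add: q_def f_def d_def)
  ultimately have "\<sigma>' * (norm d)\<^sup>2 + 2 * q \<le> inner (g x) d - inner (g y) d"
    by simp
  then have "2 * q \<le> inner f d"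
    by (simp add: f_def inner_diff_left power2_norm_eq_inner)
  moreover have "(norm f)\<^sup>2 = (L - \<sigma>') * (2 * q)"
    using assms(4) unfolding q_def by (simp only: times_divide_eq_right) (simp add: field_simps)
  ultimately have "(norm f)\<^sup>2 \<le> (L - \<sigma>') * inner f d"
    using assms(4) by simp
  then show ?thesis by (simp only: f_def d_def)
qed

text \<open>
  Stationarity of the proximal objective \<open>w \<mapsto> \<phi>(w) + \<parallel>w - s\<parallel>\<^sup>2 / (2\<gamma>)\<close>.  Its gradient
  \<open>d\<close> at \<open>u\<close> belongs to \<open>V\<close>, hence may itself be taken as the direction of
  differentiation.
\<close>

lemma prox_mem_grad:
  assumes "s \<in> V" "\<gamma> > 0" "u \<in> prox_on V \<gamma> (\<lambda>x. ereal (\<phi> x)) s"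
  shows "u \<in> V" "s = u + \<gamma> *\<^sub>R g u"
proof -
  show u: "u \<in> V"
    using assms(3) by (simp add: prox_on_def argmin_on_def is_arg_min_def)
  have min: "\<phi> u + 1 / (2 * \<gamma>) * (norm (u - s))\<^sup>2 \<le> \<phi> w + 1 / (2 * \<gamma>) * (norm (w - s))\<^sup>2"
    if "w \<in> V" for w
    using assms(3) that by (auto simp: prox_on_def argmin_on_def is_arg_min_def not_less)
  define d where "d = g u + (1 / \<gamma>) *\<^sub>R (u - s)"
  have d: "d \<in> V" unfolding d_def by (intro mem_simps grad_mem u assms)
  define \<psi> where "\<psi> \<tau> = \<phi> (u + \<tau> *\<^sub>R d) + 1 / (2 * \<gamma>) * (norm (u + \<tau> *\<^sub>R d - s))\<^sup>2" for \<tau> :: real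
  have expand: "(norm (u + \<tau> *\<^sub>R d - s))\<^sup>2
      = (norm (u - s))\<^sup>2 + 2 * \<tau> * inner (u - s) d + \<tau>\<^sup>2 * (norm d)\<^sup>2" for \<tau>
    unfolding norm_add_scaleR_power2[symmetric] by (simp add: add_diff_eq diff_add_eq)
  have "(\<psi> has_real_derivative inner (g u) d + 1 / \<gamma> * inner (u - s) d) (at 0)"
    using line_derivative[OF u d, of 0] unfolding \<psi>_def expand
    using assms(2) by (auto intro!: derivative_eq_intros)
  moreover have "\<psi> 0 \<le> \<psi> \<tau>" for \<tau>
    using min[of "u + \<tau> *\<^sub>R d"] u d by (simp add: \<psi>_def mem_simps)
  ultimately have "inner (g u) d + 1 / \<gamma> * inner (u - s) d = 0"
    by (intro DERIV_local_min[of \<psi> _ 0 1]) auto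
  moreover have "inner (g u + (1 / \<gamma>) *\<^sub>R (u - s)) d = inner (g u) d + 1 / \<gamma> * inner (u - s) d"
    by (simp only: inner_add_left inner_scaleR_left)
  ultimately have "d = 0" unfolding d_def[symmetric] by simp
  moreover have "\<gamma> *\<^sub>R d = (u + \<gamma> *\<^sub>R g u) - s"
    using assms(2) by (simp add: d_def scaleR_add_right)
  ultimately show "s = u + \<gamma> *\<^sub>R g u" by simp
qed

end

section \<open>Sufficiency\<close>

text \<open>
  The right-hand sides of the next two lemmas are lower bounds for \<open>2\<lambda>\<gamma>\<close> times the decrease
  of the envelope, in the scaled quantities \<open>a = \<gamma>\<sigma>'\<close> with a modulus \<open>\<sigma>' \<le> \<sigma>\<close>, \<open>l = \<gamma>L\<close>,
  \<open>d\<close> the step of \<open>u\<close>, and \<open>F + a d\<close> the step of \<open>\<gamma>\<nabla>\<phi>\<^sub>1(u)\<close>.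

  For \<open>a \<le> 0\<close>, the hypothesis on \<open>\<langle>F, d\<rangle>\<close> bounds the mixed term from below by a multiple of
  \<open>\<parallel>F\<parallel>\<^sup>2\<close>.  What remains is affine in \<open>\<parallel>F\<parallel>\<^sup>2\<close>, which ranges over
  \<open>[0, (l - a)\<^sup>2\<parallel>d\<parallel>\<^sup>2]\<close>, so it is smallest at an endpoint; the endpoints correspond to gradient
  steps \<open>a d\<close> and \<open>l d\<close>, and give the two arguments of the minimum.
\<close>

lemma quadratic_form_nonpos_modulus:
  fixes a l lam :: real and d F :: "'a::real_inner"
  assumes "a \<le> 0" "a < l" "l < 1" "lam < 2 * (1 + a)" "0 < lam"
    and coco: "(norm F)\<^sup>2 \<le> (l - a) * inner F d"
  shows "min ((1 - a) * (2 + 2 * a - lam)) ((1 - l) * (2 + 2 * l - lam)) * (norm d)\<^sup>2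
    \<le> lam * (a * (norm d)\<^sup>2 + (norm F)\<^sup>2 / (l - a)) + (2 - lam) * (norm d)\<^sup>2
        - 2 * (norm (F + a *\<^sub>R d))\<^sup>2"
proof -
  define T X Y Z where "T = l - a" and "X = (norm d)\<^sup>2" and "Y = (norm F)\<^sup>2" and "Z = inner F d"
  define A C B where "A = (1 - a) * (2 + 2 * a - lam)" and "C = (1 - l) * (2 + 2 * l - lam)"
    and "B = lam - 2 * l - 2 * a"
  have T: "T > 0" using assms by (simp add: T_def)
  have YZ: "Y / T \<le> Z" using coco T by (simp add: Y_def T_def Z_def field_simps)
  have XY: "X \<ge> 0" "Y \<ge> 0" by (simp_all add: X_def Y_def)
  have YX: "Y \<le> T\<^sup>2 * X"
  proof -
    have "norm F * norm F \<le> T * norm d * norm F"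
    proof -
      have "norm F * norm F \<le> T * inner F d" using coco by (simp add: T_def power2_eq_square)
      also have "\<dots> \<le> T * (norm F * norm d)"
        using T by (intro mult_left_mono norm_cauchy_schwarz) simp
      finally show ?thesis by (simp add: mult_ac)
    qed
    then have "norm F \<le> T * norm d"
      using T by (cases "norm F = 0") auto
    then have "(norm F)\<^sup>2 \<le> (T * norm d)\<^sup>2" by (intro power_mono) auto
    then show ?thesis by (simp add: X_def Y_def power_mult_distrib)
  qed
  have E: "(norm (F + a *\<^sub>R d))\<^sup>2 = Y + 2 * a * Z + a\<^sup>2 * X"
    by (simp add: X_def Y_def Z_def norm_add_scaleR_power2)
  have "- a * (Y / T) \<le> - a * Z" using YZ assms(1) by (intro mult_left_mono) auto
  then have "4 * a * Z \<le> 4 * a * (Y / T)" by linarith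
  moreover have "2 * Y = 2 * (l - a) * (Y / T)"
    using T by (simp add: T_def[symmetric])
  then have "lam * (Y / T) - 2 * Y - 4 * a * (Y / T) = B * (Y / T)"
    unfolding B_def by algebra
  moreover have "A * X = lam * (a * X) + (2 - lam) * X - 2 * (a\<^sup>2 * X)"
    by (simp add: A_def power2_eq_square algebra_simps)
  ultimately have 1: "A * X + B * (Y / T)
      \<le> lam * (a * X + Y / T) + (2 - lam) * X - 2 * (Y + 2 * a * Z + a\<^sup>2 * X)"
    by (simp add: distrib_left)
  have "min A C * X \<le> A * X + B * (Y / T)"
  proof (cases "B \<ge> 0")
    case True
    then have "B * (Y / T) \<ge> 0" using T XY by simp
    moreover have "min A C * X \<le> A * X" using XY by (intro mult_right_mono) auto
    ultimately show ?thesis by linarith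
  next
    case False
    have "Y / T \<le> T * X" using YX T by (simp add: field_simps power2_eq_square)
    then have "B * (T * X) \<le> B * (Y / T)" using False by (intro mult_left_mono_neg) auto
    moreover have "C = A + B * T" by (simp add: A_def B_def C_def T_def algebra_simps)
    then have "C * X = A * X + B * (T * X)" by (simp add: algebra_simps)
    moreover have "min A C * X \<le> C * X" using XY by (intro mult_right_mono) auto
    ultimately show ?thesis by linarith
  qed
  then show ?thesis
    using 1 unfolding E A_def C_def X_def[symmetric] Y_def[symmetric]
      T_def[symmetric] by linarith
qed

text \<open>
  For \<open>\<lambda> = 2\<close> the contribution \<open>(2 - \<lambda>)\<parallel>d\<parallel>\<^sup>2\<close> vanishes, but for \<open>a > 0\<close> the form is
  still positive definite, as completing the square in \<open>F\<close> shows.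
\<close>

lemma quadratic_form_pos_modulus:
  fixes a l :: real and d F :: "'a::real_inner"
  assumes "0 < a" "a < l" "l < 1"
  shows "2 * a * (1 - l) / (1 - l + a) * (norm d)\<^sup>2
    \<le> 2 * (a * (norm d)\<^sup>2 + (norm F)\<^sup>2 / (l - a)) - 2 * (norm (F + a *\<^sub>R d))\<^sup>2"
proof -
  define T X Y Z where "T = l - a" and "X = (norm d)\<^sup>2" and "Y = (norm F)\<^sup>2" and "Z = inner F d"
  have T: "T > 0" "T < 1" using assms by (auto simp: T_def)
  have E: "(norm (F + a *\<^sub>R d))\<^sup>2 = Y + 2 * a * Z + a\<^sup>2 * X"
    by (simp add: X_def Y_def Z_def norm_add_scaleR_power2)
  \<comment> \<open>The form is minimal in \<open>F\<close> where the vector below vanishes.\<close>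
  have "0 \<le> (norm ((1 - T) *\<^sub>R F - (a * T) *\<^sub>R d))\<^sup>2" by simp
  also have "\<dots> = (1 - T)\<^sup>2 * Y - 2 * (1 - T) * a * T * Z + (a * T)\<^sup>2 * X"
    unfolding X_def Y_def Z_def power2_norm_eq_inner
    by (simp add: inner_diff inner_commute power2_eq_square algebra_simps)
  finally have sq: "0 \<le> (1 - T)\<^sup>2 * Y - 2 * (1 - T) * a * T * Z + (a * T)\<^sup>2 * X" .
  have "2 * (a * X + Y / T) - 2 * (Y + 2 * a * Z + a\<^sup>2 * X) - 2 * a * (1 - T - a) / (1 - T) * X
      = 2 * ((1 - T)\<^sup>2 * Y - 2 * (1 - T) * a * T * Z + (a * T)\<^sup>2 * X) / (T * (1 - T))"
    using T by (simp add: divide_simps) (simp add: power2_eq_square algebra_simps)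
  also have "\<dots> \<ge> 0" using sq T by simp
  finally show ?thesis
    unfolding E X_def[symmetric] Y_def[symmetric] T_def by (simp add: algebra_simps)
qed

context smooth_hypoconvex
begin

text \<open>
  The infimum over \<open>w\<close> of \<open>\<phi>\<^sub>2(w)\<close> plus this function is the Douglas--Rachford envelope at
  the point \<open>s\<close> with proximal point \<open>u\<close>.
\<close>

definition model :: "real \<Rightarrow> 'a \<Rightarrow> 'a \<Rightarrow> real" where
  "model \<gamma> u w = \<phi> u + inner (g u) (w - u) + 1 / (2 * \<gamma>) * (norm (w - u))\<^sup>2"

text \<open>
  As a function of \<open>w\<close>, the model differs from the quadratic term in the proximal problem at
  \<open>u - \<gamma> g(u) = 2u - s\<close> by a constant, so the second DRS step minimises \<open>\<phi>\<^sub>2\<close> plus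
  the model.
\<close>

lemma model_eq_prox_objective:
  assumes "\<gamma> > 0"
  shows "model \<gamma> u w
    = 1 / (2 * \<gamma>) * (norm (w - (u - \<gamma> *\<^sub>R g u)))\<^sup>2 + (\<phi> u - \<gamma> / 2 * (norm (g u))\<^sup>2)"
proof -
  have "(norm (w - (u - \<gamma> *\<^sub>R g u)))\<^sup>2
      = (norm (w - u))\<^sup>2 + 2 * \<gamma> * inner (g u) (w - u) + \<gamma>\<^sup>2 * (norm (g u))\<^sup>2"
    using norm_add_scaleR_power2[of "w - u" \<gamma> "g u"] by (simp add: inner_commute algebra_simps)
  then show ?thesis using assms by (simp add: model_def field_simps power2_eq_square)
qed

text \<open>
  The envelope is bounded below by the minimum of \<open>\<phi>\<^sub>1 + \<phi>\<^sub>2\<close> thanks to this inequality.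
\<close>

lemma model_above:
  assumes "u \<in> V" "w \<in> V" "\<gamma> > 0" "\<gamma> * L \<le> 1"
  shows "\<phi> w \<le> model \<gamma> u w"
proof -
  have "L / 2 \<le> 1 / (2 * \<gamma>)" using assms by (simp add: field_simps)
  then have "L / 2 * (norm (w - u))\<^sup>2 \<le> 1 / (2 * \<gamma>) * (norm (w - u))\<^sup>2"
    by (intro mult_right_mono) auto
  then show ?thesis using descent[OF assms(1,2)] by (simp add: model_def)
qed

text \<open>
  The hypothesis is the update of \<open>s\<close> expressed through \<open>s = u + \<gamma> g(u)\<close>.  It allows one to
  eliminate \<open>v\<close> from the decrease of the model: with \<open>d\<close>, \<open>e\<close> the differences of the
  points and of the gradients, \<open>v\<close> enters only through \<open>\<langle>v - u, d - \<gamma>e\<rangle>\<close>, and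
  \<open>v - u\<close> is a multiple of \<open>d + \<gamma>e\<close>.
\<close>

lemma model_change:
  assumes "\<gamma> > 0" and step: "(u' - u) + \<gamma> *\<^sub>R (g u' - g u) = lam *\<^sub>R (v - u)"
  shows "2 * lam * \<gamma> * (model \<gamma> u v - model \<gamma> u' v)
    = 2 * lam * \<gamma> * (\<phi> u - \<phi> u' - inner (g u') (u - u'))
      + (2 - lam) * (norm (u' - u))\<^sup>2 - 2 * (norm (\<gamma> *\<^sub>R (g u' - g u)))\<^sup>2"
proof -
  define d r e where "d = u' - u" and "r = v - u" and "e = g u' - g u"
  have st: "lam *\<^sub>R r = d + \<gamma> *\<^sub>R e" using step by (simp add: d_def r_def e_def)
  have vu': "v - u' = r - d" and uu': "u - u' = - d" and gu: "g u = g u' - e"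
    by (simp_all add: d_def r_def e_def)
  define D where "D = \<phi> u - \<phi> u' - inner (g u') (u - u')"
  define N where "N = 2 * inner r d - (norm d)\<^sup>2"
  have "(norm (r - d))\<^sup>2 = (norm r)\<^sup>2 - N"
    unfolding power2_norm_eq_inner N_def by (simp add: inner_diff inner_commute)
  then have "model \<gamma> u v - model \<gamma> u' v = D - inner r e + N / (2 * \<gamma>)"
    unfolding model_def vu' uu' r_def[symmetric] gu D_def
    by (simp add: inner_diff inner_commute add_divide_distrib diff_divide_distrib)
  then have "2 * \<gamma> * (model \<gamma> u v - model \<gamma> u' v) = 2 * \<gamma> * D - 2 * \<gamma> * inner r e + N"
    using assms(1) by (simp add: distrib_left right_diff_distrib)
  also have "\<dots> = 2 * \<gamma> * D - (norm d)\<^sup>2 + 2 * inner r (d - \<gamma> *\<^sub>R e)"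
    by (simp add: N_def inner_diff_right)
  finally have "lam * (2 * \<gamma> * (model \<gamma> u v - model \<gamma> u' v))
      = lam * (2 * \<gamma> * D - (norm d)\<^sup>2 + 2 * inner r (d - \<gamma> *\<^sub>R e))" by simp
  then have "2 * lam * \<gamma> * (model \<gamma> u v - model \<gamma> u' v)
      = 2 * lam * \<gamma> * D - lam * (norm d)\<^sup>2 + 2 * inner (lam *\<^sub>R r) (d - \<gamma> *\<^sub>R e)"
    unfolding inner_scaleR_left by (simp only: distrib_left right_diff_distrib mult_ac)
  also have "inner (lam *\<^sub>R r) (d - \<gamma> *\<^sub>R e) = (norm d)\<^sup>2 - (norm (\<gamma> *\<^sub>R e))\<^sup>2"
    unfolding st power2_norm_eq_inner by (simp add: inner_diff inner_add inner_commute)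
  finally show ?thesis
    unfolding D_def d_def[symmetric] e_def[symmetric] by (simp only: left_diff_distrib) simp
qed

text \<open>
  Interpolation bounds the function values in \<open>model_change\<close>, with \<open>F = \<gamma>f\<close> where
  \<open>f\<close> is the gradient difference without its part \<open>\<sigma>' d\<close>; cocoercivity supplies the
  premise under which positivity of the form is available.
\<close>

lemma model_decrease_of_quadratic_form:
  assumes "\<gamma> > 0" "lam > 0" "\<sigma>' \<le> \<sigma>" "\<sigma>' < L" "u \<in> V" "u' \<in> V"
    and step: "(u' - u) + \<gamma> *\<^sub>R (g u' - g u) = lam *\<^sub>R (v - u)"
    and form: "\<And>d F :: 'a. (norm F)\<^sup>2 \<le> (\<gamma> * L - \<gamma> * \<sigma>') * inner F d \<Longrightarrow>
      \<kappa> * (norm d)\<^sup>2 \<le> lam * (\<gamma> * \<sigma>' * (norm d)\<^sup>2 + (norm F)\<^sup>2 / (\<gamma> * L - \<gamma> * \<sigma>'))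
        + (2 - lam) * (norm d)\<^sup>2 - 2 * (norm (F + (\<gamma> * \<sigma>') *\<^sub>R d))\<^sup>2"
  shows "model \<gamma> u' v + \<kappa> / (2 * lam * \<gamma>) * (norm (u' - u))\<^sup>2 \<le> model \<gamma> u v"
proof -
  define d where "d = u' - u"
  define f where "f = g u' - g u - \<sigma>' *\<^sub>R d"
  define F where "F = \<gamma> *\<^sub>R f"
  have T: "L - \<sigma>' > 0" using assms by simp
  have neg: "g u - g u' - \<sigma>' *\<^sub>R (u - u') = - f" "u - u' = - d"
    by (simp_all add: f_def d_def algebra_simps)
  have coco: "(norm f)\<^sup>2 \<le> (L - \<sigma>') * inner f d"
    using cocoercive[OF \<open>u' \<in> V\<close> \<open>u \<in> V\<close> assms(3,4)] by (simp add: f_def d_def)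
  have "(norm F)\<^sup>2 \<le> (\<gamma> * L - \<gamma> * \<sigma>') * inner F d"
    using mult_left_mono[OF coco, of "\<gamma>\<^sup>2"]
    by (simp add: F_def power_mult_distrib power2_eq_square algebra_simps)
  note form[OF this]
  moreover have "F + (\<gamma> * \<sigma>') *\<^sub>R d = \<gamma> *\<^sub>R (g u' - g u)"
    by (simp add: F_def f_def algebra_simps)
  moreover have "(norm F)\<^sup>2 / (\<gamma> * L - \<gamma> * \<sigma>') = \<gamma> * (norm f)\<^sup>2 / (L - \<sigma>')"
    using T assms(1)
    by (simp add: F_def power_mult_distrib power2_eq_square right_diff_distrib[symmetric])
  ultimately have "\<kappa> * (norm d)\<^sup>2
      \<le> lam * (\<gamma> * \<sigma>' * (norm d)\<^sup>2 + \<gamma> * (norm f)\<^sup>2 / (L - \<sigma>'))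
        + (2 - lam) * (norm d)\<^sup>2 - 2 * (norm (\<gamma> *\<^sub>R (g u' - g u)))\<^sup>2" by simp
  also have "lam * (\<gamma> * \<sigma>' * (norm d)\<^sup>2 + \<gamma> * (norm f)\<^sup>2 / (L - \<sigma>'))
      = 2 * lam * \<gamma> * (\<sigma>' / 2 * (norm d)\<^sup>2 + (norm f)\<^sup>2 / (2 * (L - \<sigma>')))"
    using T by (simp add: field_simps)
  also have "\<dots> \<le> 2 * lam * \<gamma> * (\<phi> u - \<phi> u' - inner (g u') (u - u'))"
    using interpolation[OF \<open>u \<in> V\<close> \<open>u' \<in> V\<close> assms(3,4)] assms(1,2)
    unfolding neg(1) by (intro mult_left_mono) (simp_all only: neg(2) norm_minus_cancel, simp)
  finally have "\<kappa> * (norm d)\<^sup>2 \<le> 2 * lam * \<gamma> * (model \<gamma> u v - model \<gamma> u' v)"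
    unfolding model_change[OF assms(1) step] by (simp add: d_def)
  then have "\<kappa> * (norm d)\<^sup>2 / (2 * lam * \<gamma>) \<le> model \<gamma> u v - model \<gamma> u' v"
    using assms(1,2) by (subst pos_divide_le_eq) (auto simp: mult_ac)
  then show ?thesis by (simp add: d_def)
qed

text \<open>
  For \<open>\<lambda> < 2\<close> positive curvature can be given up, so the modulus is lowered to
  \<open>min \<sigma> 0\<close>.  For \<open>\<lambda> = 2\<close> a positive modulus is essential, and any one below
  \<open>L\<close> and \<open>\<sigma>\<close> serves.
\<close>

lemma model_decrease:
  assumes "L > 0" "\<gamma> > 0" "lam > 0" "\<gamma> * L < 1"
    and lam: "lam < 2 \<and> lam < 2 * (1 + \<gamma> * \<sigma>) \<or> lam = 2 \<and> \<sigma> > 0"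
  obtains \<kappa> where "\<kappa> > 0"
    "\<And>u u' v. u \<in> V \<Longrightarrow> u' \<in> V \<Longrightarrow> (u' - u) + \<gamma> *\<^sub>R (g u' - g u) = lam *\<^sub>R (v - u) \<Longrightarrow>
      model \<gamma> u' v + \<kappa> * (norm (u' - u))\<^sup>2 \<le> model \<gamma> u v"
proof (cases "lam < 2")
  case True
  define \<sigma>' where "\<sigma>' = min \<sigma> 0"
  define a l where "a = \<gamma> * \<sigma>'" and "l = \<gamma> * L"
  define \<kappa> where "\<kappa> = min ((1 - a) * (2 + 2 * a - lam)) ((1 - l) * (2 + 2 * l - lam))"
  have a: "a \<le> 0" "lam < 2 * (1 + a)"
    using assms True by (auto simp: a_def \<sigma>'_def min_def mult_nonneg_nonpos)
  have l: "0 < l" "l < 1" using assms by (auto simp: l_def)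
  have "\<kappa> > 0" using a l by (auto simp: \<kappa>_def intro!: mult_pos_pos)
  then have pos: "\<kappa> / (2 * lam * \<gamma>) > 0" using assms by simp
  have form: "\<kappa> * (norm d)\<^sup>2 \<le> lam * (a * (norm d)\<^sup>2 + (norm F)\<^sup>2 / (l - a)) + (2 - lam) * (norm d)\<^sup>2
        - 2 * (norm (F + a *\<^sub>R d))\<^sup>2" if "(norm F)\<^sup>2 \<le> (l - a) * inner F d" for d F :: 'a
    unfolding \<kappa>_def using a l assms(3) that by (intro quadratic_form_nonpos_modulus) auto
  show ?thesis
    by (rule that[OF pos], rule model_decrease_of_quadratic_form[where \<sigma>' = \<sigma>'])
      (use assms form in \<open>auto simp: a_def l_def \<sigma>'_def\<close>)
next
  case False
  then have lam2: "lam = 2" and "\<sigma> > 0" using lam by auto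
  define \<sigma>' where "\<sigma>' = min \<sigma> (L / 2)"
  define a l where "a = \<gamma> * \<sigma>'" and "l = \<gamma> * L"
  define \<kappa> where "\<kappa> = 2 * a * (1 - l) / (1 - l + a)"
  have \<sigma>': "0 < \<sigma>'" "\<sigma>' < L" "\<sigma>' \<le> \<sigma>" using \<open>\<sigma> > 0\<close> assms(1) by (auto simp: \<sigma>'_def)
  have al: "0 < a" "a < l" "l < 1" using assms \<sigma>' by (auto simp: a_def l_def)
  have "\<kappa> > 0" unfolding \<kappa>_def using al by (intro divide_pos_pos mult_pos_pos) auto
  then have pos: "\<kappa> / (2 * lam * \<gamma>) > 0" using assms by simp
  have form: "\<kappa> * (norm d)\<^sup>2 \<le> lam * (a * (norm d)\<^sup>2 + (norm F)\<^sup>2 / (l - a)) + (2 - lam) * (norm d)\<^sup>2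
        - 2 * (norm (F + a *\<^sub>R d))\<^sup>2" for d F :: 'a
    using quadratic_form_pos_modulus[OF al, of d F] by (simp add: \<kappa>_def lam2)
  show ?thesis
    by (rule that[OF pos], rule model_decrease_of_quadratic_form[where \<sigma>' = \<sigma>'])
      (use assms form \<sigma>' in \<open>auto simp: a_def l_def\<close>)
qed

text \<open>
  The envelope values \<open>a k\<close> decrease and are bounded below, so their differences tend to zero;
  up to a factor these dominate the squared steps of \<open>u\<close>.  Lipschitz continuity of the gradient then bounds
  \<open>\<lambda> (v - u)\<close> by \<open>1 + \<gamma>L\<close> times the step of \<open>u\<close>.
\<close>

theorem DRS_residual_tendsto_zero:
  assumes "L > 0" "\<gamma> > 0" "lam > 0" "\<gamma> * L < 1"
    and lam: "lam < 2 \<and> lam < 2 * (1 + \<gamma> * \<sigma>) \<or> lam = 2 \<and> \<sigma> > 0"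
    and proper: "proper_on V \<phi>\<^sub>2"
    and argmin: "argmin_on V (\<lambda>x. ereal (\<phi> x) + \<phi>\<^sub>2 x) \<noteq> {}"
    and "s0 \<in> V" and DRS: "DRS_sequence V \<gamma> lam \<phi> \<phi>\<^sub>2 s0 s u v"
  shows "(\<lambda>k. u k - v k) \<longlonglongrightarrow> 0"
proof -
  have u_prox: "u k \<in> prox_on V \<gamma> (\<lambda>x. ereal (\<phi> x)) (s k)"
    and v_prox: "v k \<in> prox_on V \<gamma> \<phi>\<^sub>2 (2 *\<^sub>R u k - s k)"
    and s_Suc: "s (Suc k) = s k + lam *\<^sub>R (v k - u k)" for k
    using DRS by (auto simp: DRS_sequence_def)
  have v_mem: "v k \<in> V" for k
    using v_prox[of k] by (simp add: prox_on_def argmin_on_def is_arg_min_def)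
  have s_mem: "s k \<in> V" for k
  proof (induction k)
    case 0
    then show ?case using DRS \<open>s0 \<in> V\<close> by (simp add: DRS_sequence_def)
  next
    case (Suc k)
    then show ?case
      using prox_mem_grad(1)[OF Suc assms(2) u_prox] v_mem by (simp add: s_Suc mem_simps)
  qed
  note u_mem = prox_mem_grad(1)[OF s_mem assms(2) u_prox]
    and s_eq = prox_mem_grad(2)[OF s_mem assms(2) u_prox]
  obtain y where y: "y \<in> V" "\<phi>\<^sub>2 y \<noteq> \<infinity>" using proper by (auto simp: proper_on_def)
  have not_MInf: "\<phi>\<^sub>2 x \<noteq> -\<infinity>" if "x \<in> V" for x using proper that by (auto simp: proper_on_def)
  \<comment> \<open>\<open>\<phi>\<^sub>2\<close> is finite at every \<open>v k\<close> and at the minimiser, so the descent argument takes place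
    in the reals.\<close>
  define h where "h x = real_of_ereal (\<phi>\<^sub>2 x)" for x
  have h: "\<phi>\<^sub>2 x = ereal (h x)" if "x \<in> V" "\<phi>\<^sub>2 x \<noteq> \<infinity>" for x
    using not_MInf[of x] that by (cases "\<phi>\<^sub>2 x") (simp_all add: h_def)
  have v_fin: "\<phi>\<^sub>2 (v k) \<noteq> \<infinity>" for k
    using v_prox[of k] y h[OF y] by (force simp: prox_on_def argmin_on_def is_arg_min_def not_less)
  have v_min: "h (v k) + model \<gamma> (u k) (v k) \<le> h w + model \<gamma> (u k) w"
    if w: "w \<in> V" "\<phi>\<^sub>2 w \<noteq> \<infinity>" for k w
  proof -
    have c: "2 *\<^sub>R u k - s k = u k - \<gamma> *\<^sub>R g (u k)"
      by (subst s_eq) (simp add: scaleR_2)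
    have "\<phi>\<^sub>2 (v k) + ereal (1 / (2 * \<gamma>) * (norm (v k - (2 *\<^sub>R u k - s k)))\<^sup>2)
        \<le> \<phi>\<^sub>2 w + ereal (1 / (2 * \<gamma>) * (norm (w - (2 *\<^sub>R u k - s k)))\<^sup>2)"
      using v_prox[of k] w by (auto simp: prox_on_def argmin_on_def is_arg_min_def not_less)
    then show ?thesis
      unfolding h[OF w] h[OF v_mem v_fin] c model_eq_prox_objective[OF assms(2)] by simp
  qed
  obtain x where x: "x \<in> V" "\<And>w. w \<in> V \<Longrightarrow> ereal (\<phi> x) + \<phi>\<^sub>2 x \<le> ereal (\<phi> w) + \<phi>\<^sub>2 w"
    using argmin by (force simp: argmin_on_def is_arg_min_def not_less)
  have x_fin: "\<phi>\<^sub>2 x \<noteq> \<infinity>"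
    using x(2)[OF y(1)] h[OF y] by auto
  define a where "a k = h (v k) + model \<gamma> (u k) (v k)" for k
  have a_lower: "\<phi> x + h x \<le> a k" for k
  proof -
    have "\<phi> x + h x \<le> \<phi> (v k) + h (v k)"
      using x(2)[OF v_mem[of k]] by (simp add: h[OF x(1) x_fin] h[OF v_mem v_fin])
    also have "\<dots> \<le> a k"
      using model_above[OF u_mem v_mem assms(2)] assms(4) by (simp add: a_def)
    finally show ?thesis .
  qed
  have step: "(u (Suc k) - u k) + \<gamma> *\<^sub>R (g (u (Suc k)) - g (u k)) = lam *\<^sub>R (v k - u k)" for k
  proof -
    have "lam *\<^sub>R (v k - u k) = s (Suc k) - s k" by (simp add: s_Suc)
    then show ?thesis unfolding s_eq by (simp add: scaleR_diff_right)
  qed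
  obtain \<kappa> where \<kappa>: "\<kappa> > 0" and decrease: "\<And>u u' v. u \<in> V \<Longrightarrow> u' \<in> V \<Longrightarrow>
      (u' - u) + \<gamma> *\<^sub>R (g u' - g u) = lam *\<^sub>R (v - u) \<Longrightarrow>
      model \<gamma> u' v + \<kappa> * (norm (u' - u))\<^sup>2 \<le> model \<gamma> u v"
    using model_decrease[OF assms(1-4) lam] by blast
  \<comment> \<open>The old \<open>v k\<close> competes with \<open>v (Suc k)\<close> in the new model.\<close>
  have a_Suc: "\<kappa> * (norm (u (Suc k) - u k))\<^sup>2 \<le> a k - a (Suc k)" for k
    using decrease[OF u_mem u_mem step, of k] v_min[OF v_mem v_fin, of "Suc k" k]
    unfolding a_def by linarith
  have "decseq a"
  proof (rule decseq_SucI)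
    fix k
    have "0 \<le> \<kappa> * (norm (u (Suc k) - u k))\<^sup>2" using \<kappa> by simp
    then show "a (Suc k) \<le> a k" using a_Suc[of k] by linarith
  qed
  then obtain A where "a \<longlonglongrightarrow> A" using decseq_convergent[of a "\<phi> x + h x"] a_lower by blast
  then have "(\<lambda>k. a k - a (Suc k)) \<longlonglongrightarrow> A - A" by (intro tendsto_diff LIMSEQ_Suc)
  then have "(\<lambda>k. (a k - a (Suc k)) / \<kappa>) \<longlonglongrightarrow> (A - A) / \<kappa>"
    using \<kappa> by (intro tendsto_divide tendsto_const) auto
  then have "(\<lambda>k. sqrt ((a k - a (Suc k)) / \<kappa>)) \<longlonglongrightarrow> sqrt ((A - A) / \<kappa>)"
    by (rule tendsto_real_sqrt)
  then have "(\<lambda>k. (1 + \<gamma> * L) / lam * sqrt ((a k - a (Suc k)) / \<kappa>))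
      \<longlonglongrightarrow> (1 + \<gamma> * L) / lam * sqrt ((A - A) / \<kappa>)"
    by (intro tendsto_mult tendsto_const)
  then have bound_lim: "(\<lambda>k. (1 + \<gamma> * L) / lam * sqrt ((a k - a (Suc k)) / \<kappa>)) \<longlonglongrightarrow> 0" by simp
  show ?thesis
  proof (rule Lim_null_comparison[OF _ bound_lim], intro always_eventually allI)
    fix k
    let ?d = "u (Suc k) - u k"
    have "norm (g (u (Suc k)) - g (u k)) \<le> L * norm ?d"
      using lipschitz_onD[OF grad_lipschitz u_mem u_mem] by (simp add: dist_norm)
    then have "\<gamma> * norm (g (u (Suc k)) - g (u k)) \<le> \<gamma> * (L * norm ?d)"
      using assms(2) by (intro mult_left_mono) auto
    then have "norm (lam *\<^sub>R (v k - u k)) \<le> norm ?d + \<gamma> * (L * norm ?d)"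
      unfolding step[symmetric] using assms(2) by (intro norm_triangle_le) simp
    then have "lam * norm (u k - v k) \<le> (1 + \<gamma> * L) * norm ?d"
      using assms(3) by (simp add: norm_minus_commute distrib_right mult.assoc)
    then have "norm (u k - v k) \<le> (1 + \<gamma> * L) / lam * norm ?d"
      using assms(3) by (simp add: field_simps)
    also have "norm ?d \<le> sqrt ((a k - a (Suc k)) / \<kappa>)"
      using a_Suc[of k] \<kappa> by (intro real_le_rsqrt) (simp add: field_simps)
    then have "(1 + \<gamma> * L) / lam * norm ?d \<le> (1 + \<gamma> * L) / lam * sqrt ((a k - a (Suc k)) / \<kappa>)"
      using assms(1-3) by (intro mult_left_mono) auto
    finally show "norm (u k - v k) \<le> (1 + \<gamma> * L) / lam * sqrt ((a k - a (Suc k)) / \<kappa>)" .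
  qed
qed

end

section \<open>Counterexamples\<close>

definition set_indicator :: "'a set \<Rightarrow> 'a \<Rightarrow> ereal" where
  "set_indicator S x = (if x \<in> S then 0 else \<infinity>)"

lemma lsc_set_indicator:
  assumes "closed S"
  shows "lsc_on V (set_indicator S)"
  unfolding lsc_on_def
proof
  fix x
  have "\<forall>\<^sub>F y in at x within V. set_indicator S x \<le> set_indicator S y"
  proof (cases "x \<in> S")
    case False
    then have "\<forall>\<^sub>F y in at x within V. y \<in> - S"
      using assms by (auto simp: eventually_at_topological intro!: exI[of _ "- S"])
    then show ?thesis by (rule eventually_mono) (simp add: set_indicator_def)
  qed (simp add: set_indicator_def)
  then show "set_indicator S x \<le> Liminf (at x within V) (set_indicator S)"
    by (rule Liminf_bounded)
qed

lemma prox_set_indicator: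
  assumes "v \<in> S" "S \<subseteq> V" "\<gamma> > 0" "\<And>w. w \<in> S \<Longrightarrow> norm (v - x) \<le> norm (w - x)"
  shows "v \<in> prox_on V \<gamma> (set_indicator S) x"
proof -
  have "1 / (2 * \<gamma>) * (norm (v - x))\<^sup>2 \<le> 1 / (2 * \<gamma>) * (norm (w - x))\<^sup>2" if "w \<in> S" for w
    using assms that by (intro mult_left_mono power_mono) auto
  then show ?thesis
    using assms(1,2)
    by (auto simp: prox_on_def argmin_on_def is_arg_min_def not_less set_indicator_def)
qed

lemma L_smooth_on_quadratic:
  assumes "subspace V" "\<bar>c\<bar> \<le> L"
  shows "L_smooth_on L V (\<lambda>x. c / 2 * (norm x)\<^sup>2)"
  unfolding L_smooth_on_def
proof (intro exI[of _ "\<lambda>x. c *\<^sub>R x"] conjI ballI)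
  fix x assume "x \<in> V"
  then show "c *\<^sub>R x \<in> V" using assms(1) by (rule subspace_scale[rotated])
  show "((\<lambda>x. c / 2 * (norm x)\<^sup>2) has_derivative (\<lambda>h. inner (c *\<^sub>R x) h)) (at x within V)"
    unfolding power2_norm_eq_inner
    by (auto intro!: derivative_eq_intros simp: inner_commute algebra_simps)
next
  show "L-lipschitz_on V (\<lambda>x. c *\<^sub>R x)"
  proof (rule lipschitz_onI)
    fix x y
    have "norm (c *\<^sub>R x - c *\<^sub>R y) = \<bar>c\<bar> * norm (x - y)"
      unfolding scaleR_diff_right[symmetric] by (rule norm_scaleR)
    also have "\<dots> \<le> L * norm (x - y)" using assms(2) by (intro mult_right_mono) auto
    finally show "dist (c *\<^sub>R x) (c *\<^sub>R y) \<le> L * dist x y" by (simp add: dist_norm)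
  qed (use assms(2) in linarith)
qed

lemma hypoconvex_on_quadratic:
  assumes "convex V" "\<sigma> \<le> c"
  shows "hypoconvex_on \<sigma> V (\<lambda>x. c / 2 * (norm x)\<^sup>2)"
proof -
  have "convex_on V (\<lambda>x. (c - \<sigma>) / 2 * (norm x)\<^sup>2)"
  proof (rule convex_onI)
    fix t :: real and x y :: 'a assume t: "0 < t" "t < 1"
    have "(1 - t) * (norm x)\<^sup>2 + t * (norm y)\<^sup>2 - (norm ((1 - t) *\<^sub>R x + t *\<^sub>R y))\<^sup>2
        = t * (1 - t) * (norm (x - y))\<^sup>2"
      unfolding power2_norm_eq_inner
      by (simp add: inner_diff inner_add inner_commute algebra_simps)
    also have "\<dots> \<ge> 0" using t by simp
    finally have "(c - \<sigma>) / 2 * (norm ((1 - t) *\<^sub>R x + t *\<^sub>R y))\<^sup>2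
        \<le> (c - \<sigma>) / 2 * ((1 - t) * (norm x)\<^sup>2 + t * (norm y)\<^sup>2)"
      using assms(2) by (intro mult_left_mono) auto
    then show "(c - \<sigma>) / 2 * (norm ((1 - t) *\<^sub>R x + t *\<^sub>R y))\<^sup>2
        \<le> (1 - t) * ((c - \<sigma>) / 2 * (norm x)\<^sup>2) + t * ((c - \<sigma>) / 2 * (norm y)\<^sup>2)"
      by (simp only: distrib_left mult_ac)
  qed (rule assms(1))
  then show ?thesis
    unfolding hypoconvex_on_def by (simp only: left_diff_distrib diff_divide_distrib)
qed

text \<open>
  The proximal objective exceeds its value at \<open>u\<close> by exactly
  \<open>(1 + \<gamma>c) \<parallel>w - u\<parallel>\<^sup>2 / (2\<gamma>)\<close>.
\<close>

lemma prox_quadratic: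
  assumes "u \<in> V" "\<gamma> > 0" "1 + \<gamma> * c > 0"
  shows "u \<in> prox_on V \<gamma> (\<lambda>x. ereal (c / 2 * (norm x)\<^sup>2)) ((1 + \<gamma> * c) *\<^sub>R u)"
proof -
  have "c / 2 * (norm u)\<^sup>2 + 1 / (2 * \<gamma>) * (norm (u - (1 + \<gamma> * c) *\<^sub>R u))\<^sup>2
      \<le> c / 2 * (norm w)\<^sup>2 + 1 / (2 * \<gamma>) * (norm (w - (1 + \<gamma> * c) *\<^sub>R u))\<^sup>2" for w
  proof -
    define e where "e = w - u"
    have "(norm (u - (1 + \<gamma> * c) *\<^sub>R u))\<^sup>2 = (\<gamma> * c)\<^sup>2 * (norm u)\<^sup>2"
      by (simp add: algebra_simps power_mult_distrib)
    moreover have "(norm w)\<^sup>2 = (norm u)\<^sup>2 + 2 * inner u e + (norm e)\<^sup>2"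
      using norm_add_scaleR_power2[of u 1 e] by (simp add: e_def)
    moreover have "(norm (w - (1 + \<gamma> * c) *\<^sub>R u))\<^sup>2
        = (norm e)\<^sup>2 - 2 * (\<gamma> * c) * inner u e + (\<gamma> * c)\<^sup>2 * (norm u)\<^sup>2"
      using norm_add_scaleR_power2[of e "- (\<gamma> * c)" u]
      by (simp add: e_def algebra_simps inner_commute)
    ultimately have "c / 2 * (norm w)\<^sup>2 + 1 / (2 * \<gamma>) * (norm (w - (1 + \<gamma> * c) *\<^sub>R u))\<^sup>2
        - (c / 2 * (norm u)\<^sup>2 + 1 / (2 * \<gamma>) * (norm (u - (1 + \<gamma> * c) *\<^sub>R u))\<^sup>2)
        = (1 + \<gamma> * c) * (norm e)\<^sup>2 / (2 * \<gamma>)"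
      using assms(2) by (simp add: field_simps)
    also have "\<dots> \<ge> 0" using assms by simp
    finally show ?thesis by simp
  qed
  then show ?thesis
    using assms(1) by (auto simp: prox_on_def argmin_on_def is_arg_min_def not_less)
qed

text \<open>
  A finite domain for \<open>\<phi>\<^sub>2\<close> makes a minimiser exist whatever the sign of the curvature.
\<close>

lemma quadratic_indicator_in_class_C:
  assumes "finite S" "S \<noteq> {}" "S \<subseteq> euclid p" "\<bar>c\<bar> \<le> L" "\<sigma> \<le> c"
  shows "(\<lambda>x. c / 2 * (norm x)\<^sup>2, set_indicator S) \<in> class_C p L \<sigma>"
proof -
  let ?q = "\<lambda>x :: finseq. c / 2 * (norm x)\<^sup>2"
  have "Min (?q ` S) \<in> ?q ` S" using assms by (intro Min_in) auto
  then obtain m where m: "m \<in> S" "?q m = Min (?q ` S)" by auto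
  have "?q m \<le> ?q w" if "w \<in> S" for w
    unfolding m(2) using assms(1) that by (intro Min_le) auto
  then have "m \<in> argmin_on (euclid p) (\<lambda>x. ereal (?q x) + set_indicator S x)"
    using m assms(3) by (auto simp: argmin_on_def is_arg_min_def not_less set_indicator_def)
  moreover have "proper_on (euclid p) (set_indicator S)"
    using assms by (auto simp: proper_on_def set_indicator_def)
  moreover have "L_smooth_on L (euclid p) ?q"
    by (rule L_smooth_on_quadratic[OF subspace_euclid assms(4)])
  moreover have "hypoconvex_on \<sigma> (euclid p) ?q"
    by (rule hypoconvex_on_quadratic[OF subspace_imp_convex[OF subspace_euclid] assms(5)])
  moreover have "lsc_on (euclid p) (set_indicator S)"
    by (rule lsc_set_indicator[OF finite_imp_closed[OF assms(1)]])
  ultimately show ?thesis unfolding class_C_def by blast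
qed

lemma not_ensuredI:
  assumes "p \<ge> 1" "(\<phi>\<^sub>1, \<phi>\<^sub>2) \<in> class_C p L \<sigma>" "s0 \<in> euclid p"
    and "DRS_sequence (euclid p) \<gamma> lam \<phi>\<^sub>1 \<phi>\<^sub>2 s0 s u v"
    and "\<And>k. 1 \<le> norm (u k - v k)"
  shows "\<not> DRS_ensured_to_converge \<gamma> lam L \<sigma>"
proof
  assume "DRS_ensured_to_converge \<gamma> lam L \<sigma>"
  then have "(\<lambda>k. u k - v k) \<longlonglongrightarrow> 0"
    using assms(1-4) unfolding DRS_ensured_to_converge_def by blast
  then have "(\<lambda>k. norm (u k - v k)) \<longlonglongrightarrow> 0" by (rule tendsto_norm_zero)
  then have "1 \<le> (0::real)" by (rule LIMSEQ_le_const) (use assms(5) in auto)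
  then show False by simp
qed

lemma unit_vector_exists: "\<exists>e \<in> euclid 1. norm e = 1"
proof -
  obtain e where e: "e \<in> euclid 1" "coord e 0 = 1"
    using euclid_ex1[of 1 "\<lambda>_. 1"] by auto
  then have "inner e e = 1" by (simp add: inner_euclid[OF e(1)])
  then show ?thesis using e(1) by (auto simp: norm_eq_sqrt_inner)
qed

text \<open>
  With \<open>\<phi>\<^sub>1\<close> of curvature \<open>L\<close>, \<open>u = s / (1 + \<gamma>L)\<close>, hence \<open>2u - s = - c s\<close> with
  \<open>c \<ge> 0\<close> exactly because \<open>\<gamma>L \<ge> 1\<close>.  A nearest point \<open>v\<close> to it in
  \<open>{e, -e}\<close> can therefore be chosen with \<open>\<langle>v, u\<rangle> \<le> 0\<close>, and then \<open>u\<close> and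
  \<open>v\<close> are at distance at least \<open>\<parallel>v\<parallel> = 1\<close>.  For \<open>\<gamma>L = 1\<close> this uses the freedom of selection, as
  both points of the set are then nearest to the origin.
\<close>

lemma not_ensured_large_stepsize:
  assumes "L > 0" "\<gamma> > 0" "\<sigma> \<le> L" "1 \<le> \<gamma> * L"
  shows "\<not> DRS_ensured_to_converge \<gamma> lam L \<sigma>"
proof -
  obtain e where e: "e \<in> euclid 1" "norm e = 1" using unit_vector_exists by blast
  define b where "b = 1 + \<gamma> * L"
  have b: "b \<ge> 2" using assms(4) by (simp add: b_def)
  define U W where "U x = (1 / b) *\<^sub>R x" and "W x = (if inner x e \<ge> 0 then - e else e)" for x :: finseq
  define s where "s k = ((\<lambda>x. x + lam *\<^sub>R (W x - U x)) ^^ k) 0" for k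
  have W: "W x \<in> {e, - e}" "inner (W x) x \<le> 0" "norm (W x) = 1" for x
    using e(2) by (auto simp: W_def inner_commute)
  have e': "{e, - e} \<subseteq> euclid 1"
    using e(1) subspace_euclid[of 1] by (auto intro: subspace_neg)
  have U_mem: "U x \<in> euclid 1" if "x \<in> euclid 1" for x
    unfolding U_def using that by (intro subspace_scale subspace_euclid)
  have W_mem: "W x \<in> euclid 1" for x using W(1)[of x] e' by blast
  have s_0: "s 0 = 0" and s_Suc: "s (Suc k) = s k + lam *\<^sub>R (W (s k) - U (s k))" for k
    by (simp_all add: s_def)
  have zero_mem: "0 \<in> euclid 1" by (rule subspace_0[OF subspace_euclid])
  have s_mem: "s k \<in> euclid 1" for k
  proof (induction k)
    case 0
    then show ?case using zero_mem by (simp only: s_0)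
  next
    case (Suc k)
    then show ?case
      unfolding s_Suc
      by (intro subspace_add subspace_scale subspace_diff subspace_euclid U_mem W_mem)
  qed
  have W_prox: "W x \<in> prox_on (euclid 1) \<gamma> (set_indicator {e, - e}) (2 *\<^sub>R U x - x)" for x
  proof (rule prox_set_indicator[OF W(1) e' assms(2)])
    fix w assume w: "w \<in> {e, - e}"
    define c where "c = 1 - 2 / b"
    have c: "c \<ge> 0" using b by (simp add: c_def field_simps)
    have refl: "y - (2 *\<^sub>R U x - x) = y + c *\<^sub>R x" for y
      by (simp add: U_def c_def algebra_simps)
    have "inner (W x) x \<le> inner w x"
      using w by (auto simp: W_def inner_commute)
    then have "2 * c * inner (W x) x \<le> 2 * c * inner w x" using c by (intro mult_left_mono) auto
    moreover have "norm w = 1" using w e(2) by auto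
    ultimately have "(norm (W x + c *\<^sub>R x))\<^sup>2 \<le> (norm (w + c *\<^sub>R x))\<^sup>2"
      unfolding norm_add_scaleR_power2 by (simp add: W(3))
    then show "norm (W x - (2 *\<^sub>R U x - x)) \<le> norm (w - (2 *\<^sub>R U x - x))"
      unfolding refl by (rule power2_le_imp_le) simp
  qed
  have U_prox: "U x \<in> prox_on (euclid 1) \<gamma> (\<lambda>x. ereal (L / 2 * (norm x)\<^sup>2)) x" if "x \<in> euclid 1" for x
    using prox_quadratic[OF U_mem[OF that] assms(2), of L] b by (simp add: b_def[symmetric] U_def)
  have "DRS_sequence (euclid 1) \<gamma> lam (\<lambda>x. L / 2 * (norm x)\<^sup>2) (set_indicator {e, - e}) 0
      s (\<lambda>k. U (s k)) (\<lambda>k. W (s k))"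
    unfolding DRS_sequence_def by (intro conjI allI s_0 s_Suc W_prox U_prox s_mem)
  moreover have "1 \<le> norm (U x - W x)" for x
  proof -
    have "1 \<le> inner (W x) (W x - U x)"
    proof -
      have "inner (W x) (U x) \<le> 0"
        using W(2)[of x] b by (simp add: U_def divide_nonpos_pos)
      moreover have "inner (W x) (W x) = 1" using W(3)[of x] by (simp add: norm_eq_1)
      ultimately show ?thesis by (simp add: inner_diff_right)
    qed
    also have "\<dots> \<le> norm (W x) * norm (W x - U x)" by (rule norm_cauchy_schwarz)
    finally show ?thesis by (simp add: W(3) norm_minus_commute)
  qed
  moreover have "(\<lambda>x. L / 2 * (norm x)\<^sup>2, set_indicator {e, - e}) \<in> class_C 1 L \<sigma>"
    using e' assms(1,3) by (intro quadratic_indicator_in_class_C) auto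
  ultimately show ?thesis by (intro not_ensuredI[OF order_refl _ zero_mem])
qed

text \<open>
  With \<open>\<phi>\<^sub>1\<close> of curvature \<open>\<sigma>\<close> and \<open>v = 0\<close> throughout, \<open>u = s / b\<close> for
  \<open>b = 1 + \<gamma>\<sigma> > 0\<close>, and one iteration multiplies \<open>s\<close> by \<open>r = 1 - \<lambda> / b\<close>.  The
  hypothesis on the relaxation says \<open>r \<le> -1\<close>.
\<close>

lemma not_ensured_large_relaxation:
  assumes "\<gamma> > 0" "- L \<le> \<sigma>" "\<sigma> \<le> 0" "\<gamma> * L < 1" "2 * (1 + \<gamma> * \<sigma>) \<le> lam"
  shows "\<not> DRS_ensured_to_converge \<gamma> lam L \<sigma>"
proof -
  obtain e where e: "e \<in> euclid 1" "norm e = 1" using unit_vector_exists by blast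
  define b where "b = 1 + \<gamma> * \<sigma>"
  have "\<gamma> * (- L) \<le> \<gamma> * \<sigma>" using assms(1,2) by (intro mult_left_mono) auto
  then have b: "b > 0" using assms(4) by (simp add: b_def)
  define r where "r = 1 - lam / b"
  have "2 \<le> lam / b" using assms(5) b by (simp add: b_def[symmetric] field_simps)
  then have r: "\<bar>r\<bar> \<ge> 1" by (simp add: r_def)
  define u where "u k = r ^ k *\<^sub>R e" for k
  have u_mem: "u k \<in> euclid 1" for k
    unfolding u_def using e(1) by (intro subspace_scale subspace_euclid)
  have zero: "{0} \<subseteq> euclid 1" using subspace_0[OF subspace_euclid] by simp
  have u_prox: "u k \<in> prox_on (euclid 1) \<gamma> (\<lambda>x. ereal (\<sigma> / 2 * (norm x)\<^sup>2)) (b *\<^sub>R u k)" for k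
    using prox_quadratic[OF u_mem assms(1), of \<sigma> k] b by (simp only: b_def)
  have zero_prox: "0 \<in> prox_on (euclid 1) \<gamma> (set_indicator {0}) x" for x
    by (rule prox_set_indicator[OF _ zero assms(1)]) auto
  have "b * r = b - lam" using b by (simp add: r_def field_simps)
  moreover have "b *\<^sub>R u (Suc k) = (b * r) *\<^sub>R u k" for k by (simp add: u_def)
  ultimately have "b *\<^sub>R u (Suc k) = b *\<^sub>R u k + lam *\<^sub>R (0 - u k)" for k
    by (simp add: scaleR_diff_left)
  then have "DRS_sequence (euclid 1) \<gamma> lam (\<lambda>x. \<sigma> / 2 * (norm x)\<^sup>2) (set_indicator {0}) (b *\<^sub>R u 0)
      (\<lambda>k. b *\<^sub>R u k) u (\<lambda>_. 0)"
    unfolding DRS_sequence_def by (intro conjI allI refl u_prox zero_prox)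
  moreover have "1 \<le> norm (u k - 0)" for k
    using r by (simp add: u_def e(2) power_abs one_le_power)
  moreover have "b *\<^sub>R u 0 \<in> euclid 1" by (intro subspace_scale subspace_euclid u_mem)
  moreover have "(\<lambda>x. \<sigma> / 2 * (norm x)\<^sup>2, set_indicator {0}) \<in> class_C 1 L \<sigma>"
    using zero assms(2,3) by (intro quadratic_indicator_in_class_C) auto
  ultimately show ?thesis by (intro not_ensuredI[OF order_refl])
qed

section \<open>The exact range of stepsizes\<close>

text \<open>
  Any gradient witnessing smoothness will do, since the conclusion does not mention it.
\<close>

lemma ensured_to_converge:
  assumes "L > 0" "\<gamma> > 0" "lam > 0" "\<gamma> * L < 1"
    and "lam < 2 \<and> lam < 2 * (1 + \<gamma> * \<sigma>) \<or> lam = 2 \<and> \<sigma> > 0"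
  shows "DRS_ensured_to_converge \<gamma> lam L \<sigma>"
  unfolding DRS_ensured_to_converge_def
proof (intro allI impI ballI, clarify)
  fix p \<phi>\<^sub>1 \<phi>\<^sub>2 s0 s u v
  assume "(\<phi>\<^sub>1, \<phi>\<^sub>2) \<in> class_C p L \<sigma>" and s0: "s0 \<in> euclid p"
    and DRS: "DRS_sequence (euclid p) \<gamma> lam \<phi>\<^sub>1 \<phi>\<^sub>2 s0 s u v"
  then have C: "L_smooth_on L (euclid p) \<phi>\<^sub>1" "hypoconvex_on \<sigma> (euclid p) \<phi>\<^sub>1"
    "proper_on (euclid p) \<phi>\<^sub>2" "argmin_on (euclid p) (\<lambda>x. ereal (\<phi>\<^sub>1 x) + \<phi>\<^sub>2 x) \<noteq> {}"
    by (auto simp: class_C_def)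
  then obtain g where "smooth_hypoconvex (euclid p) \<phi>\<^sub>1 g L \<sigma>"
    unfolding L_smooth_on_def smooth_hypoconvex_def using subspace_euclid by blast
  then show "(\<lambda>k. u k - v k) \<longlonglongrightarrow> 0"
    using smooth_hypoconvex.DRS_residual_tendsto_zero assms C(3,4) s0 DRS by blast
qed

text \<open>
  For \<open>\<sigma> \<ge> 0\<close> the second bound on \<open>\<gamma>\<close> is infinite, and correspondingly
  \<open>\<lambda> < 2\<close> already implies the second condition on the right.
\<close>

lemma stepsize_bound_iff:
  assumes "L > 0" "lam < 2" "\<gamma> > 0"
  shows "ereal \<gamma> < min (ereal (1 / L)) (ereal (2 - lam) / ereal (2 * neg_part \<sigma>))
    \<longleftrightarrow> \<gamma> * L < 1 \<and> lam < 2 * (1 + \<gamma> * \<sigma>)"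
proof (cases "\<sigma> < 0")
  case True
  have "\<gamma> < (2 - lam) / (2 * - \<sigma>) \<longleftrightarrow> lam < 2 * (1 + \<gamma> * \<sigma>)"
    using True by (subst pos_less_divide_eq) (auto simp: algebra_simps)
  then show ?thesis using True assms by (simp add: neg_part_def pos_less_divide_eq)
next
  case False
  then have "\<gamma> * \<sigma> \<ge> 0" using assms by simp
  then have "lam < 2 * (1 + \<gamma> * \<sigma>)" using assms by (simp add: distrib_left)
  then show ?thesis
    using False assms ereal_pos_divide_zero[of "2 - lam"] by (simp add: neg_part_def pos_less_divide_eq)
qed

theorem theorem4p9:
  fixes L \<sigma> lam \<gamma> :: real
  assumes "L > 0" and "\<sigma> \<in> {-L..L}" and "lam > 0" and "\<gamma> > 0"
  shows "(lam \<in> {0<..<2} \<longrightarrow>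
            (DRS_ensured_to_converge \<gamma> lam L \<sigma> \<longleftrightarrow>
             ereal \<gamma> < min (ereal (1 / L)) (ereal (2 - lam) / ereal (2 * neg_part \<sigma>)))) \<and>
         (lam \<ge> 2 \<and> \<sigma> \<le> 0 \<longrightarrow> \<not> DRS_ensured_to_converge \<gamma> lam L \<sigma>) \<and>
         (lam = 2 \<longrightarrow>
            (DRS_ensured_to_converge \<gamma> lam L \<sigma> \<longleftrightarrow> \<sigma> > 0 \<and> \<gamma> < 1 / L))"
proof -
  let ?E = "DRS_ensured_to_converge \<gamma> lam L \<sigma>"
  have large_step: "\<not> ?E" if "\<not> \<gamma> * L < 1"
    using that assms by (intro not_ensured_large_stepsize) auto
  have large_relax: "\<not> ?E" if "\<sigma> \<le> 0" "2 * (1 + \<gamma> * \<sigma>) \<le> lam"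
    using that assms large_step not_ensured_large_relaxation[of \<gamma> L \<sigma> lam] by auto
  have nonneg: "lam < 2 * (1 + \<gamma> * \<sigma>)" if "lam < 2" "\<not> \<sigma> \<le> 0"
    using that mult_pos_pos[OF assms(4), of \<sigma>] by (simp add: distrib_left)
  have a: "?E \<longleftrightarrow> \<gamma> * L < 1 \<and> lam < 2 * (1 + \<gamma> * \<sigma>)" if "lam < 2"
    using large_step large_relax nonneg[OF that] ensured_to_converge[of L \<gamma> lam \<sigma>] assms that
    by (meson not_le)
  have b: "\<not> ?E" if "2 \<le> lam" "\<sigma> \<le> 0"
  proof -
    have "\<gamma> * \<sigma> \<le> 0" using assms(4) that(2) by (simp add: mult_nonneg_nonpos)
    then show ?thesis using that by (intro large_relax) auto
  qed
  have c: "?E \<longleftrightarrow> \<sigma> > 0 \<and> \<gamma> < 1 / L" if "lam = 2"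
    using b large_step ensured_to_converge[of L \<gamma> lam \<sigma>] assms that
    by (auto simp: pos_less_divide_eq not_less[symmetric])
  show ?thesis
    using a b c stepsize_bound_iff[of L lam \<gamma> \<sigma>] assms by auto
qed

end
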